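(* Let $n\ge 1$ be an integer and let $C_1, C_2, \dots$ be independent random variables, each uniformly distributed on $\{1,\dots,n\}$ (so each of the $n$ coupons is collected with probability $\frac1n$ at each draw). Let $N$ be the number of draws needed to complete the collection, $N=\min\{t\ge 1 : \{C_1,\dots,C_t\}=\{1,\dots,n\}\}$. Then $$V(N) = n^2\sum_{i=1}^n \frac{1}{i^2}-n\sum_{k=1}^n \frac{1}{k}.$$
   Context: Coupon collector's problem: there are $n$ coupon types; $C_t$ denotes the type of the coupon obtained at the $t$-th purchase, and $N$ is the number of coupons purchased until at least one coupon of each type has been obtained. $V$ denotes variance. *)

theory Defs
  imports "HOL-Probability.Probability"
begin

text \<open>
  The argument \<open>c\<close> is one realised sequence of draws \<open>c 1, c 2, \<dots>\<close>; the entry \<open>c 0\<close> is never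
  used. If the collection is never completed, then \<open>LEAST\<close> yields an unspecified constant. For
  independent uniform draws this happens only on a null set, so it does not affect the
  distribution of the number of draws.
\<close>
definition num_draws :: "nat \<Rightarrow> (nat \<Rightarrow> nat) \<Rightarrow> nat" where
  "num_draws n c = (LEAST t. t \<ge> 1 \<and> c ` {1..t} = {1..n})"

end

theory Submission
  imports Defs
begin

text \<open>
  The number of distinct coupons owned after \<open>t\<close> draws is a pure birth chain which moves from
  \<open>k\<close> to \<open>k + 1\<close> with probability \<open>(n - k) / n\<close>. Writing \<open>a k t\<close> for the probability that it
  is at \<open>k\<close> at time \<open>t\<close>, the recurrence of the chain determines \<open>\<Sum>t. a k t\<close> and
  \<open>\<Sum>t. t * a k t\<close>. Since \<open>N > t\<close> holds almost surely iff the chain is below \<open>n\<close> at time \<open>t\<close>,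
  these series give the tail-sum formulas \<open>E N = (\<Sum>t. P (N > t))\<close> and
  \<open>E (N\<^sup>2) = (\<Sum>t. (2 * t + 1) * P (N > t))\<close>.
\<close>

section \<open>The series of a pure birth chain\<close>

text \<open>Summing the recurrence over all \<open>t\<close> gives
  \<open>S - x 0 = q * S + Y\<close> for the total \<open>S\<close>, which determines
  \<open>S\<close> because \<open>q < 1\<close>. This is legitimate only once the series is known to
  converge, so the partial sums are bounded first.\<close>

lemma affine_recurrence_sums:
  fixes x y :: "nat \<Rightarrow> real"
  assumes q: "0 \<le> q" "q < 1"
    and nonneg: "\<And>t. 0 \<le> x t" "\<And>t. 0 \<le> y t"
    and step: "\<And>t. x (Suc t) = q * x t + y t"
    and y: "y sums Y"
  shows "x sums ((x 0 + Y) / (1 - q))"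
proof -
  \<comment> \<open>The bound is the fixed point of the map taking \<open>s\<close> to
    \<open>x 0 + q * s + Y\<close>. Passing from \<open>m\<close> to \<open>Suc m\<close> applies at
    most this map, so the partial sums never exceed it.\<close>
  have bound: "(\<Sum>t<m. x t) \<le> (x 0 + Y) / (1 - q)" for m
  proof (induction m)
    case 0
    have "0 \<le> Y"
      using y nonneg(2) sums_le[OF _ sums_zero y] by auto
    then show ?case
      using q nonneg(1)[of 0] by simp
  next
    case (Suc m)
    have "(\<Sum>t<Suc m. x t) = x 0 + (\<Sum>t<m. x (Suc t))"
      by (rule sum.lessThan_Suc_shift)
    also have "\<dots> = x 0 + q * (\<Sum>t<m. x t) + (\<Sum>t<m. y t)"
      by (simp add: step sum.distrib sum_distrib_left)
    also have "\<dots> \<le> x 0 + q * ((x 0 + Y) / (1 - q)) + Y"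
      using Suc q y nonneg(2) sum_le_suminf[of y "{..<m}"]
      by (intro add_mono mult_left_mono) (auto simp: sums_iff)
    also have "\<dots> = (x 0 + Y) / (1 - q)"
      using q by (simp add: field_simps)
    finally show ?case .
  qed
  have summ: "summable x"
    by (rule summableI_nonneg_bounded[OF nonneg(1) bound])
  then have sx: "x sums (\<Sum>t. x t)"
    by (rule summable_sums)
  have "(\<lambda>t. x (Suc t)) sums (q * (\<Sum>t. x t) + Y)"
    unfolding step by (intro sums_add sums_mult sx y)
  moreover have "(\<lambda>t. x (Suc t)) sums ((\<Sum>t. x t) - x 0)"
    using sx by (simp add: sums_Suc_iff)
  ultimately have "(\<Sum>t. x t) - x 0 = q * (\<Sum>t. x t) + Y"
    by (rule sums_unique2[symmetric])
  then have "(\<Sum>t. x t) = (x 0 + Y) / (1 - q)"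
    using q by (simp add: field_simps)
  with sx show ?thesis
    by simp
qed

locale birth_chain =
  fixes n :: nat and a :: "nat \<Rightarrow> nat \<Rightarrow> real"
  assumes n_pos: "0 < n"
    and nonneg: "0 \<le> a k t"
    and init: "a k 0 = (if k = 0 then 1 else 0)"
    and step_0: "a 0 (Suc t) = 0"
    and step_Suc: "a (Suc k) (Suc t)
        = real (Suc k) / real n * a (Suc k) t + (real n - real k) / real n * a k t"
begin

lemma at_0: "a 0 t = (if t = 0 then 1 else 0)"
  by (cases t) (simp_all add: init step_0)

text \<open>The time spent at \<open>k\<close> is geometric with success probability
  \<open>(n - k) / n\<close>, and the sum is its mean.\<close>

lemma occupation_sums:
  assumes "k < n"
  shows "a k sums (real n / (real n - real k))"
  using assms
proof (induction k)
  case 0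
  have "(\<lambda>t. if t = 0 then 1 else 0 :: real) sums 1"
    using sums_single[of 0 "\<lambda>_. 1::real"] by simp
  then show ?case
    using 0 by (simp add: at_0)
next
  case (Suc k)
  let ?q = "real (Suc k) / real n"
  have "(\<lambda>t. (real n - real k) / real n * a k t) sums
      ((real n - real k) / real n * (real n / (real n - real k)))"
    using Suc by (intro sums_mult) auto
  \<comment> \<open>The total inflow into \<open>Suc k\<close> is 1: the chain enters each state
    exactly once.\<close>
  also have "(real n - real k) / real n * (real n / (real n - real k)) = 1"
    using Suc.prems by simp
  finally have "a (Suc k) sums ((a (Suc k) 0 + 1) / (1 - ?q))"
    using Suc.prems by (intro affine_recurrence_sums) (auto simp: nonneg step_Suc)
  also have "(a (Suc k) 0 + 1) / (1 - ?q) = real n / (real n - real (Suc k))"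
    using Suc.prems by (simp add: init field_simps)
  finally show ?case .
qed

text \<open>The sequence \<open>t * a k t\<close> obeys an affine recurrence with the same factor
  \<open>q\<close> as \<open>a k\<close>; its inhomogeneous part contains the series of the previous
  state and the plain occupation sums.\<close>

lemma weighted_occupation_sums:
  assumes "k < n"
  shows "(\<lambda>t. real t * a k t) sums
    ((real n)\<^sup>2 / (real n - real k) * (harm (n - 1) - harm (n - 1 - k)))"
  using assms
proof (induction k)
  case 0
  have "(\<lambda>t. real t * a 0 t) = (\<lambda>_. 0)"
    by (auto simp: at_0)
  then show ?case
    by simp
next
  case (Suc k)
  define r where "r = (real n - real k) / real n"
  let ?q = "real (Suc k) / real n"
  let ?T = "(real n)\<^sup>2 / (real n - real k) * (harm (n - 1) - harm (n - 1 - k))"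
  \<comment> \<open>Splitting the weight \<open>Suc t\<close> into \<open>t + 1\<close> leaves these
    terms besides \<open>?q * (t * a (Suc k) t)\<close>.\<close>
  let ?y = "\<lambda>t. ?q * a (Suc k) t + (r * (real t * a k t) + r * a k t)"
  let ?Y = "?q * (real n / (real n - real (Suc k))) + (r * ?T + r * (real n / (real n - real k)))"
  have "r \<ge> 0"
    using Suc.prems by (simp add: r_def)
  have y: "?y sums ?Y"
    using Suc by (intro sums_add sums_mult occupation_sums) auto
  have "(\<lambda>t. real t * a (Suc k) t) sums ((real 0 * a (Suc k) 0 + ?Y) / (1 - ?q))"
  proof (rule affine_recurrence_sums)
    show "0 \<le> ?q" "?q < 1"
      using Suc.prems by simp_all
    show "0 \<le> real t * a (Suc k) t" "0 \<le> ?y t" for t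
      using \<open>r \<ge> 0\<close> by (simp_all add: nonneg)
    show "real (Suc t) * a (Suc k) (Suc t) = ?q * (real t * a (Suc k) t) + ?y t" for t
      by (simp add: step_Suc r_def[symmetric] algebra_simps add_divide_distrib)
  qed (rule y)
  also have "(real 0 * a (Suc k) 0 + ?Y) / (1 - ?q)
      = (real n)\<^sup>2 / (real n - real (Suc k)) * (harm (n - 1) - harm (n - 1 - Suc k))"
  proof -
    \<comment> \<open>Writing \<open>m\<close> for \<open>n - 2 - k\<close> removes the truncated
      subtractions from the indices of \<open>harm\<close>.\<close>
    obtain m where m: "n = Suc (Suc (k + m))"
      using Suc.prems less_iff_Suc_add by auto
    have d: "n - 1 - k = Suc m" "n - 1 - Suc k = m"
      by (simp_all add: m)
    have c: "real n - real (Suc k) = real m + 1" "real n - real k = real m + 2"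
      by (simp_all add: m)
    have h: "harm (Suc m) = harm m + 1 / (real m + 1)"
      by (simp add: harm_Suc field_simps)
    have q: "1 - ?q = (real m + 1) / real n"
      using n_pos c by (simp add: field_simps)
    define z where "z = harm (n - 1) - (harm m :: real)"
    have "r * ?T = real n * (z - 1 / (real m + 1))"
      using n_pos unfolding r_def d c h z_def by (simp add: power2_eq_square)
    moreover have "r * (real n / (real n - real k)) = 1"
      using n_pos unfolding r_def c by simp
    moreover have "?q * (real n / (real n - real (Suc k))) = real (Suc k) / (real m + 1)"
      using n_pos unfolding c by simp
    ultimately have "?Y = real (Suc k) / (real m + 1) + (real n * (z - 1 / (real m + 1)) + 1)"
      by (simp only: distrib_left add.assoc)
    also have "\<dots> = real n * z"
    proof -
      \<comment> \<open>Since \<open>n = (k + 1) + (m + 1)\<close>, this cancels everything in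
        \<open>?Y\<close> except \<open>n * z\<close>.\<close>
      have "real (Suc k) / (real m + 1) = real n / (real m + 1) - 1"
        by (simp add: m field_simps)
      then show ?thesis
        by (simp add: right_diff_distrib)
    qed
    finally have "?Y = real n * z" .
    then show ?thesis
      unfolding q d c z_def[symmetric] by (simp add: power2_eq_square)
  qed
  finally show ?case .
qed

end

section \<open>Harmonic sums and the tail series over all states below \<open>n\<close>\<close>

text \<open>In the square of \<open>harm n\<close>, expanded over pairs of indices, each
  off-diagonal pair occurs twice and the diagonal gives the reciprocal squares. This is the source
  of the sum of reciprocal squares in the variance.\<close>

lemma harm_pred_div_sum:
  "2 * (\<Sum>i=1..n. harm (i - 1) / real i) = (harm n :: real)\<^sup>2 - (\<Sum>i=1..n. 1 / (real i)\<^sup>2)"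
proof (induction n)
  case (Suc n)
  have "2 * (\<Sum>i=1..Suc n. harm (i - 1) / real i)
      = (harm n)\<^sup>2 - (\<Sum>i=1..n. 1 / (real i)\<^sup>2) + 2 * (harm n / real (Suc n))"
    using Suc by (simp add: algebra_simps)
  also have "\<dots> = (harm n + 1 / real (Suc n))\<^sup>2 - (\<Sum>i=1..Suc n. 1 / (real i)\<^sup>2)"
    by (simp add: power2_sum power_divide)
  finally show ?case
    by (simp add: harm_Suc inverse_eq_divide)
qed (simp add: harm_def)

lemma sum_reflect:
  fixes f :: "nat \<Rightarrow> real"
  shows "(\<Sum>k<n. f (n - k)) = (\<Sum>i=1..n. f i)"
  by (rule sum.reindex_bij_witness[of _ "\<lambda>i. n - i" "\<lambda>k. n - k"]) auto

context birth_chain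
begin

lemma tail_sums: "(\<lambda>t. \<Sum>k<n. a k t) sums (real n * harm n)"
proof -
  have "(\<lambda>t. \<Sum>k<n. a k t) sums (\<Sum>k<n. real n / (real n - real k))"
    by (intro sums_sum occupation_sums) auto
  also have "(\<Sum>k<n. real n / (real n - real k)) = (\<Sum>k<n. real n / real (n - k))"
    by (intro sum.cong) (auto simp: of_nat_diff)
  also have "\<dots> = real n * harm n"
    unfolding sum_reflect[of "\<lambda>i. real n / real i"]
    by (simp add: harm_def sum_distrib_left inverse_eq_divide)
  finally show ?thesis .
qed

text \<open>The weights \<open>2 * t + 1\<close> sum to squares, so this series will be the second
  moment. The substitution \<open>i = n - k\<close> turns the sum over states into one that
  \<open>harm_pred_div_sum\<close> evaluates.\<close>

lemma weighted_tail_sums: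
  "(\<lambda>t. (2 * real t + 1) * (\<Sum>k<n. a k t)) sums
    ((real n)\<^sup>2 * ((harm n)\<^sup>2 + (\<Sum>i=1..n. 1 / (real i)\<^sup>2)) - real n * harm n)"
proof -
  have "(\<lambda>t. 2 * (\<Sum>k<n. real t * a k t) + (\<Sum>k<n. a k t)) sums
      (2 * (\<Sum>k<n. (real n)\<^sup>2 / (real n - real k) * (harm (n - 1) - harm (n - 1 - k)))
        + real n * harm n)"
    by (intro sums_add sums_mult sums_sum weighted_occupation_sums tail_sums) auto
  also have "(\<lambda>t. 2 * (\<Sum>k<n. real t * a k t) + (\<Sum>k<n. a k t))
      = (\<lambda>t. (2 * real t + 1) * (\<Sum>k<n. a k t))"
    by (simp add: sum_distrib_left sum.distrib[symmetric] algebra_simps)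
  also have "(\<Sum>k<n. (real n)\<^sup>2 / (real n - real k) * (harm (n - 1) - harm (n - 1 - k)))
      = (\<Sum>k<n. (real n)\<^sup>2 / real (n - k) * (harm (n - 1) - harm (n - k - 1)))"
    by (intro sum.cong) (auto simp: of_nat_diff)
  also have "\<dots> = (\<Sum>i=1..n. (real n)\<^sup>2 / real i * (harm (n - 1) - harm (i - 1)))"
    by (rule sum_reflect)
  also have "\<dots> = (real n)\<^sup>2 * (harm n * harm (n - 1) - (\<Sum>i=1..n. harm (i - 1) / real i))"
    unfolding harm_def[of n]
    by (simp add: sum_distrib_left sum_distrib_right sum_subtractf[symmetric] algebra_simps
        inverse_eq_divide)
  also have "2 * \<dots> + real n * harm n
      = (real n)\<^sup>2 * ((harm n)\<^sup>2 + (\<Sum>i=1..n. 1 / (real i)\<^sup>2)) - real n * harm n"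
  proof -
    \<comment> \<open>The correction \<open>1 / n\<close> contributes
      \<open>- 2 * n * harm n\<close>; the weight 1 adds back one \<open>n * harm n\<close>.\<close>
    have pred: "harm (n - 1) = harm n - 1 / real n"
      using n_pos by (cases n) (auto simp: harm_Suc inverse_eq_divide)
    have "2 * ((real n)\<^sup>2 * (harm n * harm (n - 1) - (\<Sum>i=1..n. harm (i - 1) / real i)))
        = (real n)\<^sup>2 * (2 * (harm n * harm (n - 1)) - 2 * (\<Sum>i=1..n. harm (i - 1) / real i))"
      by (simp add: algebra_simps)
    also have "\<dots> = (real n)\<^sup>2 * ((harm n)\<^sup>2 + (\<Sum>i=1..n. 1 / (real i)\<^sup>2)) - 2 * (real n * harm n)"
      unfolding harm_pred_div_sum pred using n_pos
      by (simp add: field_simps power2_eq_square)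
    finally show ?thesis
      by simp
  qed
  finally show ?thesis .
qed

end

section \<open>Moments from tail probabilities\<close>

text \<open>The random sum is the series of \<open>w t\<close> times the indicator of
  \<open>t < N\<close>, and nonnegative terms allow integral and series to be exchanged. Computing
  in \<open>ennreal\<close> yields integrability together with the value.\<close>

lemma (in prob_space) has_bochner_integral_sum_tail:
  fixes N :: "'a \<Rightarrow> nat" and w :: "nat \<Rightarrow> real"
  assumes N[measurable]: "N \<in> measurable M (count_space UNIV)"
    and w: "\<And>t. 0 \<le> w t"
    and sums: "(\<lambda>t. w t * prob {\<omega> \<in> space M. t < N \<omega>}) sums s"
  shows "has_bochner_integral M (\<lambda>\<omega>. \<Sum>t<N \<omega>. w t) s"
proof (rule has_bochner_integral_nn_integral)
  show "(\<lambda>\<omega>. \<Sum>t<N \<omega>. w t) \<in> borel_measurable M"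
    by measurable
  show "AE \<omega> in M. 0 \<le> (\<Sum>t<N \<omega>. w t)"
    by (simp add: w sum_nonneg)
  show "0 \<le> s"
    using sums_le[OF _ sums_zero sums] w by simp
  have "(\<integral>\<^sup>+\<omega>. ennreal (\<Sum>t<N \<omega>. w t) \<partial>M)
      = (\<integral>\<^sup>+\<omega>. (\<Sum>t. ennreal (w t) * indicator {\<omega> \<in> space M. t < N \<omega>} \<omega>) \<partial>M)"
  proof (intro nn_integral_cong)
    fix \<omega> assume \<omega>: "\<omega> \<in> space M"
    have "(\<Sum>t. ennreal (w t) * indicator {\<omega> \<in> space M. t < N \<omega>} \<omega>)
        = (\<Sum>t<N \<omega>. ennreal (w t) * indicator {\<omega> \<in> space M. t < N \<omega>} \<omega>)"
      by (intro suminf_finite) auto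
    then show "ennreal (\<Sum>t<N \<omega>. w t)
        = (\<Sum>t. ennreal (w t) * indicator {\<omega> \<in> space M. t < N \<omega>} \<omega>)"
      using \<omega> w by (simp add: sum_ennreal)
  qed
  also have "\<dots> = (\<Sum>t. ennreal (w t) * emeasure M {\<omega> \<in> space M. t < N \<omega>})"
    by (subst nn_integral_suminf) (auto simp: nn_integral_cmult_indicator)
  also have "\<dots> = (\<Sum>t. ennreal (w t * prob {\<omega> \<in> space M. t < N \<omega>}))"
    by (simp add: emeasure_eq_measure ennreal_mult w)
  also have "\<dots> = ennreal s"
    using sums w by (intro suminf_ennreal_eq) auto
  finally show "(\<integral>\<^sup>+\<omega>. ennreal (\<Sum>t<N \<omega>. w t) \<partial>M) = ennreal s" .
qed

lemma sum_odd_lessThan: "(\<Sum>t<N. 2 * real t + 1) = (real N)\<^sup>2"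
  by (induction N) (simp_all add: power2_eq_square algebra_simps)

section \<open>The collection process\<close>

text \<open>The assumption \<open>complete\<close> makes the \<open>LEAST\<close> attained. The
  assumption \<open>range\<close> keeps the collection complete afterwards, since later draws cannot
  leave \<open>{1..n}\<close>.\<close>

lemma num_draws_gt_iff:
  assumes "1 \<le> n" and range: "\<And>t. 1 \<le> t \<Longrightarrow> c t \<in> {1..n}" and complete: "c ` {1..T} = {1..n}"
  shows "t < num_draws n c \<longleftrightarrow> c ` {1..t} \<noteq> {1..n}"
proof -
  let ?P = "\<lambda>t. 1 \<le> t \<and> c ` {1..t} = {1..n}"
  \<comment> \<open>No draws give the empty set, which differs from \<open>{1..n}\<close> as
    \<open>1 \<le> n\<close>.\<close>
  have pos: "1 \<le> t" if "c ` {1..t} = {1..n}" for t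
    using that assms(1) by (cases t) auto
  have "?P T"
    using pos complete by blast
  then have attained: "c ` {1..num_draws n c} = {1..n}"
    unfolding num_draws_def by (rule LeastI2) blast
  have "c ` {1..t} = {1..n}" if "num_draws n c \<le> t"
  proof
    show "c ` {1..t} \<subseteq> {1..n}"
      using range by (intro image_subsetI) simp
    show "{1..n} \<subseteq> c ` {1..t}"
      unfolding attained[symmetric] using that by (intro image_mono) simp
  qed
  moreover have "num_draws n c \<le> t" if "c ` {1..t} = {1..n}"
    unfolding num_draws_def using that pos by (intro Least_le conjI)
  ultimately show ?thesis
    using not_le by blast
qed

text \<open>Double counting: pairs \<open>(B, j)\<close> with \<open>j\<close> in \<open>B\<close>
  correspond to pairs \<open>(A, j)\<close> with \<open>j\<close> outside
  \<open>A = B - {j}\<close>, and each \<open>A\<close> leaves \<open>card S - k\<close> choices of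
  \<open>j\<close>.\<close>

lemma sum_card_Diff_singleton:
  fixes f :: "'b set \<Rightarrow> real"
  assumes "finite S"
  shows "(\<Sum>B | B \<subseteq> S \<and> card B = Suc k. \<Sum>j\<in>B. f (B - {j}))
    = (real (card S) - real k) * (\<Sum>A | A \<subseteq> S \<and> card A = k. f A)"
proof -
  have "(\<Sum>B | B \<subseteq> S \<and> card B = Suc k. \<Sum>j\<in>B. f (B - {j}))
      = (\<Sum>(B, j) \<in> Sigma {B. B \<subseteq> S \<and> card B = Suc k} (\<lambda>B. B). f (B - {j}))"
    using assms by (intro sum.Sigma) (auto intro: finite_subset)
  also have "\<dots> = (\<Sum>(A, j) \<in> Sigma {A. A \<subseteq> S \<and> card A = k} (\<lambda>A. S - A). f A)"
    using assms
    by (intro sum.reindex_bij_witness[of _ "\<lambda>(A, j). (insert j A, j)" "\<lambda>(B, j). (B - {j}, j)"])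
      (auto simp: insert_absorb card_insert_if finite_subset)
  also have "\<dots> = (\<Sum>A | A \<subseteq> S \<and> card A = k. \<Sum>j\<in>S - A. f A)"
    using assms by (intro sum.Sigma[symmetric]) auto
  also have "\<dots> = (\<Sum>A | A \<subseteq> S \<and> card A = k. (real (card S) - real k) * f A)"
    using assms
    by (intro sum.cong) (auto simp: card_Diff_subset finite_subset of_nat_diff card_mono)
  finally show ?thesis
    by (simp add: sum_distrib_left)
qed

text \<open>Expresses equality of sets by quantifiers over sets that are finite in every use below,
  so that measurability follows from that of the single draws.\<close>

lemma image_eq_iff_bounded:
  "f ` I = A \<longleftrightarrow> (\<forall>s\<in>I. f s \<in> A) \<and> (\<forall>a\<in>A. \<exists>s\<in>I. f s = a)"
  by auto

section \<open>The law of the set of collected coupons\<close>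

locale coupon_collector = prob_space M for M :: "'a measure" +
  fixes C :: "nat \<Rightarrow> 'a \<Rightarrow> nat" and n :: nat
  assumes n_ge_1: "1 \<le> n"
    and indep: "indep_vars (\<lambda>_. count_space UNIV) C {1..}"
    and uniform: "1 \<le> t \<Longrightarrow> distr M (count_space UNIV) (C t) = measure_pmf (pmf_of_set {1..n})"
begin

definition collected :: "nat \<Rightarrow> 'a \<Rightarrow> nat set" where
  "collected t \<omega> = (\<lambda>s. C s \<omega>) ` {1..t}"

definition prob_collected :: "nat \<Rightarrow> nat set \<Rightarrow> real" where
  "prob_collected t A = prob {\<omega> \<in> space M. collected t \<omega> = A}"

text \<open>A sum over sets, rather than the probability of an event about cardinality, because the
  recurrence is first proved for each set separately. Both agree since the draws lie in
  \<open>{1..n}\<close> almost surely.\<close>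

definition prob_count :: "nat \<Rightarrow> nat \<Rightarrow> real" where
  "prob_count k t = (\<Sum>A | A \<subseteq> {1..n} \<and> card A = k. prob_collected t A)"

lemma measurable_C[measurable]: "1 \<le> t \<Longrightarrow> C t \<in> measurable M (count_space UNIV)"
  using indep by (auto simp: indep_vars_def)

lemma collected_Suc: "collected (Suc t) \<omega> = insert (C (Suc t) \<omega>) (collected t \<omega>)"
  by (simp add: collected_def atLeastAtMostSuc_conv)

lemma finite_collected: "finite (collected t \<omega>)"
  by (simp add: collected_def)

lemma measurable_collected_eq[measurable]:
  "Measurable.pred M (\<lambda>\<omega>. collected t \<omega> = A)"
proof (cases "finite A")
  case True
  then show ?thesis
    unfolding collected_def image_eq_iff_bounded by measurable
next
  case False
  then have "(\<lambda>\<omega>. collected t \<omega> = A) = (\<lambda>_. False)"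
    using finite_collected by auto
  then show ?thesis
    by simp
qed

lemma prob_draw:
  assumes "1 \<le> t" "j \<in> {1..n}"
  shows "prob {\<omega> \<in> space M. C t \<omega> = j} = 1 / real n"
proof -
  have "prob {\<omega> \<in> space M. C t \<omega> = j} = measure (distr M (count_space UNIV) (C t)) {j}"
    using assms by (subst measure_distr) (auto intro!: arg_cong[where f = prob])
  also have "\<dots> = 1 / real n"
    using assms by (simp add: uniform measure_pmf_single)
  finally show ?thesis .
qed

lemma AE_draw_range: "AE \<omega> in M. \<forall>t\<ge>1. C t \<omega> \<in> {1..n}"
proof -
  have "AE \<omega> in M. C t \<omega> \<in> {1..n}" if "1 \<le> t" for t
  proof -
    have "AE x in distr M (count_space UNIV) (C t). x \<in> {1..n}"
      unfolding uniform[OF that] AE_measure_pmf_iff using n_ge_1 by simp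
    then show ?thesis
      using that by (subst (asm) AE_distr_iff) auto
  qed
  then show ?thesis
    by (subst AE_all_countable) (auto simp: AE_all_countable)
qed

lemma prob_collected_draw:
  assumes "j \<in> {1..n}" "finite A"
  shows "prob {\<omega> \<in> space M. collected t \<omega> = A \<and> C (Suc t) \<omega> = j} = prob_collected t A / real n"
proof -
  let ?P = "\<lambda>I. PiM I (\<lambda>_. count_space UNIV :: nat measure)"
  let ?A = "{f \<in> space (?P {1..t}). f ` {1..t} = A}"
  let ?B = "{f \<in> space (?P {Suc t}). f (Suc t) = j}"
  let ?X = "\<lambda>\<omega>. restrict (\<lambda>i. C i \<omega>) {1..t}"
  let ?Y = "\<lambda>\<omega>. restrict (\<lambda>i. C i \<omega>) {Suc t}"
  \<comment> \<open>The collected set is a function of the draws \<open>1..t\<close> alone, a block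
    disjoint from \<open>Suc t\<close>; \<open>?A\<close> and \<open>?B\<close> restate the two
    events on these blocks.\<close>
  have ind: "indep_var (?P {1..t}) ?X (?P {Suc t}) ?Y"
    by (rule indep_var_restrict[OF indep]) auto
  have "?A \<in> sets (?P {1..t})"
    unfolding image_eq_iff_bounded using assms by measurable
  moreover have "?B \<in> sets (?P {Suc t})"
    by measurable
  ultimately have "prob ((\<lambda>\<omega>. (?X \<omega>, ?Y \<omega>)) -` (?A \<times> ?B) \<inter> space M)
      = prob (?X -` ?A \<inter> space M) * prob (?Y -` ?B \<inter> space M)"
    by (rule indep_varD[OF ind])
  moreover have "?X -` ?A \<inter> space M = {\<omega> \<in> space M. collected t \<omega> = A}"
    by (auto simp: space_PiM collected_def)
  moreover have "?Y -` ?B \<inter> space M = {\<omega> \<in> space M. C (Suc t) \<omega> = j}"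
    by (auto simp: space_PiM)
  moreover have "(\<lambda>\<omega>. (?X \<omega>, ?Y \<omega>)) -` (?A \<times> ?B) \<inter> space M
      = {\<omega> \<in> space M. collected t \<omega> = A \<and> C (Suc t) \<omega> = j}"
    by (auto simp: space_PiM collected_def)
  ultimately show ?thesis
    using prob_draw[of "Suc t" j] assms by (simp add: prob_collected_def)
qed

text \<open>Split by the last draw \<open>j\<close> in \<open>B\<close>: before it the collection
  was either \<open>B\<close> or \<open>B - {j}\<close>. These cases are disjoint because
  \<open>j\<close> belongs to \<open>B\<close>.\<close>

lemma prob_collected_Suc:
  assumes "B \<subseteq> {1..n}"
  shows "prob_collected (Suc t) B
    = real (card B) / real n * prob_collected t B + (\<Sum>j\<in>B. prob_collected t (B - {j})) / real n"
proof -
  have fin: "finite B"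
    using assms by (rule finite_subset) simp
  let ?E = "\<lambda>A j. {\<omega> \<in> space M. collected t \<omega> = A \<and> C (Suc t) \<omega> = j}"
  have [measurable]: "C (Suc t) \<in> measurable M (count_space UNIV)"
    by simp
  have E: "?E A j \<in> events" for A j
    by measurable
  have "{\<omega> \<in> space M. collected (Suc t) \<omega> = B} = (\<Union>j\<in>B. ?E B j \<union> ?E (B - {j}) j)"
    by (auto simp: collected_Suc)
  then have "prob_collected (Suc t) B = prob (\<Union>j\<in>B. ?E B j \<union> ?E (B - {j}) j)"
    by (simp add: prob_collected_def)
  also have "\<dots> = (\<Sum>j\<in>B. prob (?E B j \<union> ?E (B - {j}) j))"
    using fin E by (intro finite_measure_finite_Union) (auto simp: disjoint_family_on_def)
  also have "\<dots> = (\<Sum>j\<in>B. prob (?E B j) + prob (?E (B - {j}) j))"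
    using E by (intro sum.cong finite_measure_Union) auto
  also have "\<dots> = (\<Sum>j\<in>B. prob_collected t B / real n + prob_collected t (B - {j}) / real n)"
    using assms fin by (intro sum.cong arg_cong2[where f = "(+)"] prob_collected_draw) auto
  also have "\<dots> = real (card B) / real n * prob_collected t B
      + (\<Sum>j\<in>B. prob_collected t (B - {j})) / real n"
    by (simp add: sum.distrib sum_divide_distrib)
  finally show ?thesis .
qed

lemma prob_collected_0: "prob_collected 0 A = (if A = {} then 1 else 0)"
  by (auto simp: prob_collected_def collected_def prob_space)

lemma prob_count_0: "prob_count 0 t = prob_collected t {}"
proof -
  have "{A. A \<subseteq> {1..n} \<and> card A = 0} = {{}}"
    by (auto dest: finite_subset)
  then show ?thesis
    by (simp add: prob_count_def)
qed

text \<open>All sets of one size share the same coefficients, so they merge into a single state;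
  \<open>sum_card_Diff_singleton\<close> counts the ways of entering it.\<close>

lemma prob_count_Suc:
  "prob_count (Suc k) (Suc t) = real (Suc k) / real n * prob_count (Suc k) t
    + (real n - real k) / real n * prob_count k t"
proof -
  have "prob_count (Suc k) (Suc t)
      = (\<Sum>B | B \<subseteq> {1..n} \<and> card B = Suc k. real (Suc k) / real n * prob_collected t B
          + (\<Sum>j\<in>B. prob_collected t (B - {j})) / real n)"
    unfolding prob_count_def by (intro sum.cong) (auto simp: prob_collected_Suc)
  also have "\<dots> = real (Suc k) / real n * prob_count (Suc k) t
      + (\<Sum>B | B \<subseteq> {1..n} \<and> card B = Suc k. \<Sum>j\<in>B. prob_collected t (B - {j})) / real n"
    by (simp only: sum.distrib sum_divide_distrib sum_distrib_left prob_count_def)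
  finally show ?thesis
    by (simp add: sum_card_Diff_singleton prob_count_def)
qed

sublocale birth_chain n prob_count
proof
  show "0 < n"
    using n_ge_1 by simp
  show "0 \<le> prob_count k t" for k t
    by (simp add: prob_count_def prob_collected_def sum_nonneg)
  show "prob_count k 0 = (if k = 0 then 1 else 0)" for k
  proof (cases k)
    case 0
    then show ?thesis
      by (simp add: prob_count_0 prob_collected_0)
  next
    case (Suc m)
    then show ?thesis
      by (auto simp: prob_count_def prob_collected_0 intro!: sum.neutral)
  qed
  show "prob_count 0 (Suc t) = 0" for t
    by (simp add: prob_count_0 prob_collected_def collected_Suc)
qed (rule prob_count_Suc)

lemma prob_incomplete:
  "prob {\<omega> \<in> space M. collected t \<omega> \<noteq> {1..n}} = (\<Sum>k<n. prob_count k t)"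
proof -
  \<comment> \<open>The recurrence conserves mass: the coefficients of staying at \<open>k\<close>
    and of leaving it add up to 1.\<close>
  have total: "(\<Sum>k\<le>n. prob_count k t) = 1"
  proof (induction t)
    case 0
    then show ?case
      by (simp add: init)
  next
    case (Suc t)
    have "(\<Sum>k\<le>n. prob_count k (Suc t)) = (\<Sum>k<n. prob_count (Suc k) (Suc t))"
      by (simp add: sum.atMost_shift step_0)
    also have "\<dots> = (\<Sum>k<n. real (Suc k) / real n * prob_count (Suc k) t)
        + (\<Sum>k<n. (real n - real k) / real n * prob_count k t)"
      by (simp add: step_Suc sum.distrib)
    \<comment> \<open>Both sums extend to \<open>k \<le> n\<close>: here the new term
      \<open>k = 0\<close> has coefficient 0, and below the new term \<open>k = n\<close>
      does.\<close>
    also have "(\<Sum>k<n. real (Suc k) / real n * prob_count (Suc k) t)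
        = (\<Sum>k\<le>n. real k / real n * prob_count k t)"
      by (simp add: sum.atMost_shift)
    also have "(\<Sum>k<n. (real n - real k) / real n * prob_count k t)
        = (\<Sum>k\<le>n. (real n - real k) / real n * prob_count k t)"
      by (simp add: lessThan_Suc_atMost[symmetric])
    also have "(\<Sum>k\<le>n. real k / real n * prob_count k t) + \<dots> = (\<Sum>k\<le>n. prob_count k t)"
      unfolding sum.distrib[symmetric] using n_pos by (intro sum.cong) (auto simp: field_simps)
    finally show ?case
      using Suc by simp
  qed
  have "{A. A \<subseteq> {1..n} \<and> card A = n} = {{1..n}}"
    using card_subset_eq[of "{1..n}"] by auto
  then have "prob_count n t = prob_collected t {1..n}"
    by (simp add: prob_count_def)
  moreover have "prob {\<omega> \<in> space M. collected t \<omega> \<noteq> {1..n}} = 1 - prob_collected t {1..n}"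
    unfolding prob_collected_def by (rule prob_neg) measurable
  ultimately show ?thesis
    using total by (simp add: lessThan_Suc_atMost[symmetric])
qed

text \<open>Never completing implies being incomplete at each time \<open>t\<close>, and these
  probabilities tend to 0 as the terms of a convergent series.\<close>

lemma AE_complete: "AE \<omega> in M. \<exists>t. collected t \<omega> = {1..n}"
proof -
  let ?F = "{\<omega> \<in> space M. \<forall>t. collected t \<omega> \<noteq> {1..n}}"
  have "prob ?F \<le> (\<Sum>k<n. prob_count k t)" for t
    unfolding prob_incomplete[symmetric] by (rule finite_measure_mono) auto
  moreover have "(\<lambda>t. \<Sum>k<n. prob_count k t) \<longlonglongrightarrow> 0"
    using tail_sums by (intro summable_LIMSEQ_zero) (auto simp: sums_iff)
  ultimately have "prob ?F \<le> 0"
    by (intro LIMSEQ_le_const) auto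
  then have "prob ?F = 0"
    by (simp add: measure_le_0_iff)
  moreover have "?F \<in> events"
    by measurable
  ultimately have "AE \<omega> in M. \<omega> \<notin> ?F"
    by (simp add: prob_eq_0)
  then show ?thesis
    by (rule AE_mp) auto
qed

section \<open>Moments and variance of the number of draws\<close>

abbreviation N :: "'a \<Rightarrow> nat" where
  "N \<omega> \<equiv> num_draws n (\<lambda>t. C t \<omega>)"

lemma measurable_N[measurable]: "N \<in> measurable M (count_space UNIV)"
  unfolding num_draws_def collected_def[symmetric] by measurable

lemma prob_N_gt: "prob {\<omega> \<in> space M. t < N \<omega>} = (\<Sum>k<n. prob_count k t)"
proof -
  \<comment> \<open>Only almost surely: a null set of draw sequences leaves \<open>{1..n}\<close> or
    never completes, and there \<open>num_draws\<close> carries no such information.\<close>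
  have "AE \<omega> in M. t < N \<omega> \<longleftrightarrow> collected t \<omega> \<noteq> {1..n}"
    using AE_draw_range AE_complete
  proof eventually_elim
    case (elim \<omega>)
    then obtain T where "(\<lambda>s. C s \<omega>) ` {1..T} = {1..n}"
      by (auto simp: collected_def)
    with elim show ?case
      unfolding collected_def by (intro num_draws_gt_iff[OF n_ge_1]) auto
  qed
  then have "prob {\<omega> \<in> space M. t < N \<omega>} = prob {\<omega> \<in> space M. collected t \<omega> \<noteq> {1..n}}"
    by (intro finite_measure_eq_AE) auto
  then show ?thesis
    unfolding prob_incomplete .
qed

lemma expectation_N: "has_bochner_integral M (\<lambda>\<omega>. real (N \<omega>)) (real n * harm n)"
  using has_bochner_integral_sum_tail[of N "\<lambda>_. 1"] tail_sums by (simp add: prob_N_gt)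

lemma second_moment_N:
  "has_bochner_integral M (\<lambda>\<omega>. (real (N \<omega>))\<^sup>2)
    ((real n)\<^sup>2 * ((harm n)\<^sup>2 + (\<Sum>i=1..n. 1 / (real i)\<^sup>2)) - real n * harm n)"
  using has_bochner_integral_sum_tail[of N "\<lambda>t. 2 * real t + 1"] weighted_tail_sums
  by (simp add: prob_N_gt sum_odd_lessThan)

lemma variance_N:
  "variance (\<lambda>\<omega>. real (N \<omega>))
    = (real n)\<^sup>2 * (\<Sum>i=1..n. 1 / (real i)\<^sup>2) - real n * (\<Sum>k=1..n. 1 / real k)"
proof -
  have "variance (\<lambda>\<omega>. real (N \<omega>)) = expectation (\<lambda>\<omega>. (real (N \<omega>))\<^sup>2) - (expectation (\<lambda>\<omega>. real (N \<omega>)))\<^sup>2"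
    using expectation_N second_moment_N by (intro variance_eq) (simp_all add: has_bochner_integral_iff)
  \<comment> \<open>The squared mean cancels the \<open>(harm n)\<^sup>2\<close> term of the second
    moment.\<close>
  also have "\<dots> = (real n)\<^sup>2 * (\<Sum>i=1..n. 1 / (real i)\<^sup>2) - real n * harm n"
    using expectation_N second_moment_N
    by (simp add: has_bochner_integral_iff power_mult_distrib algebra_simps)
  finally show ?thesis
    by (simp add: harm_def inverse_eq_divide)
qed

end

theorem theorem2:
  fixes M :: "'a measure" and C :: "nat \<Rightarrow> 'a \<Rightarrow> nat" and n :: nat
  assumes "prob_space M"
    and "n \<ge> 1"
    and "prob_space.indep_vars M (\<lambda>_. count_space UNIV) C {1..}"
    and "\<And>t. t \<ge> 1 \<Longrightarrow> distr M (count_space UNIV) (C t) = measure_pmf (pmf_of_set {1..n})"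
  shows "prob_space.variance M (\<lambda>\<omega>. real (num_draws n (\<lambda>t. C t \<omega>)))
    = (real n)\<^sup>2 * (\<Sum>i=1..n. 1 / (real i)\<^sup>2) - real n * (\<Sum>k=1..n. 1 / real k)"
proof -
  interpret coupon_collector M C n
    using assms by (simp add: coupon_collector_def coupon_collector_axioms_def)
  show ?thesis
    by (rule variance_N)
qed

end
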